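(* Let $f,g,F$ be as in the context (with $F=f+g$ and $F^*=\inf F>-\infty$). Suppose that for every $\gamma>0$ and $x\in\mathbb{E}$ the set $\mathrm{prox}_{g/\gamma}(x)$ is nonempty, and that there exist $\nu\in(0,1)$ and $L_\nu>0$ such that $$f(x)\le f(y)+\langle\nabla f(y),x-y\rangle+\frac{L_\nu}{1+\nu}\|x-y\|^{1+\nu}\quad\text{for all }x,y\in\mathrm{dom}\,g.$$ Let $\{x^k\}$ be a sequence generated by the auto-conditioned proximal gradient method (AC-PGM) with parameters $\alpha>1$, $L_0>0$ and $x^0\in\mathrm{dom}\,g$, satisfying $x^k\ne x^{k-1}$ for all $k\ge1$. Then, for any $k\ge1$, $$\min_{l\in[k]}\|R_{\alpha\gamma_l}(x^{l-1})\|\le\alpha\cdot\max\left\{2\sqrt{\frac{L_0(\Delta+C_\nu)}{(\alpha-1)k}},\ \left(\frac{2^{1+2\nu}L_\nu}{1+\nu}\right)^{\frac{1}{1+\nu}}\left(\frac{\Delta+C_\nu}{(\alpha-1)k}\right)^{\frac{\nu}{1+\nu}}\right\}=\mathcal{O}\big(k^{-\frac{\nu}{1+\nu}}\big),$$ where $\Delta:=F(x^0)-F^*$, $\beta:=\frac{\alpha+1}{2}$ and $$C_\nu:=\frac{1}{1-\beta^{-\frac{1+\nu}{1-\nu}}}\left(\frac{L_\nu}{1+\nu}\right)^{\frac{2}{1-\nu}}\left(\frac{2}{L_0}\right)^{\frac{1+\nu}{1-\nu}}.$$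
   Context: $\mathbb{E}$ is a finite-dimensional real inner product space with inner product $\langle\cdot,\cdot\rangle$ and induced norm $\|\cdot\|$; $\mathrm{dom}\,\phi=\{x\mid\phi(x)<\infty\}$; $[k]=\{1,\dots,k\}$. Problem: minimize $F(x):=f(x)+g(x)$ over $x\in\mathbb{E}$, where $f:\mathbb{E}\to(-\infty,\infty]$ is lower semicontinuous and continuously differentiable on an open set including $\mathrm{dom}\,g$, $g:\mathbb{E}\to(-\infty,\infty]$ is proper and lower semicontinuous, and $F^*:=\inf_{x\in\mathbb{E}}F(x)>-\infty$. $\mathrm{prox}_{g/\gamma}(x):=\operatorname{argmin}_{y\in\mathbb{E}}\{g(y)+\frac{\gamma}{2}\|y-x\|^2\}$ (a set). AC-PGM: given $x^0\in\mathrm{dom}\,g$, $\alpha>1$, $L_0>0$, for $k=1,2,\dots$ compute $\gamma_k=\max\{L_0,\dots,L_{k-1}\}$; $x^k\in\mathrm{prox}_{g/(\alpha\gamma_k)}\big(x^{k-1}-\frac{1}{\alpha\gamma_k}\nabla f(x^{k-1})\big)$ (any choice); $L_k=\dfrac{2\big(f(x^k)-f(x^{k-1})-\langle\nabla f(x^{k-1}),x^k-x^{k-1}\rangle\big)}{\|x^k-x^{k-1}\|^2}$. Gradient mapping along the iterates: $R_{\alpha\gamma_k}(x^{k-1}):=\alpha\gamma_k(x^{k-1}-x^k)$. *)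

theory Defs
  imports "HOL-Analysis.Analysis" "HOL-Library.Landau_Symbols"
begin

text \<open>Functions with values in the half-open line from minus infinity (excluded) to infinity
  (included) are functions into \<^typ>\<open>ereal\<close> that never take the value minus infinity.\<close>

definition effective_domain :: "('a \<Rightarrow> ereal) \<Rightarrow> 'a set" where
  "effective_domain \<phi> = {x. \<phi> x < \<infinity>}"

definition proper :: "('a \<Rightarrow> ereal) \<Rightarrow> bool" where
  "proper \<phi> \<longleftrightarrow> (\<forall>x. \<phi> x \<noteq> -\<infinity>) \<and> effective_domain \<phi> \<noteq> {}"

definition lower_semicontinuous :: "('a::topological_space \<Rightarrow> ereal) \<Rightarrow> bool" where
  "lower_semicontinuous \<phi> \<longleftrightarrow> (\<forall>x. \<phi> x \<le> Liminf (at x) \<phi>)"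

text \<open>Only meaningful at points around which \<open>f\<close> is finite and at which it is differentiable.\<close>

definition grad :: "('a::real_inner \<Rightarrow> ereal) \<Rightarrow> 'a \<Rightarrow> 'a" where
  "grad f x = (THE D. GDERIV (\<lambda>y. real_of_ereal (f y)) x :> D)"

text \<open>Differentiability presupposes finiteness; it has to be required separately because
  \<^const>\<open>real_of_ereal\<close> maps infinite values to 0.\<close>

definition continuously_differentiable_near :: "('a::real_inner \<Rightarrow> ereal) \<Rightarrow> 'a set \<Rightarrow> bool" where
  "continuously_differentiable_near f S \<longleftrightarrow>
     (\<exists>U. open U \<and> S \<subseteq> U \<and>
        (\<forall>x\<in>U. \<bar>f x\<bar> \<noteq> \<infinity> \<and> (\<exists>D. GDERIV (\<lambda>y. real_of_ereal (f y)) x :> D)) \<and>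
        continuous_on U (grad f))"

text \<open>\<open>prox g \<gamma>\<close> is the set-valued proximal operator of the function \<open>g / \<gamma>\<close>.\<close>

definition prox :: "('a::real_inner \<Rightarrow> ereal) \<Rightarrow> real \<Rightarrow> 'a \<Rightarrow> 'a set" where
  "prox g \<gamma> x = {y. is_arg_min (\<lambda>y. g y + ereal (\<gamma> / 2 * (norm (y - x))\<^sup>2)) (\<lambda>_. True) y}"

text \<open>The estimates \<open>L\<^sub>k\<close> and step parameters \<open>\<gamma>\<^sub>k\<close> are determined by \<open>L\<^sub>0\<close> and the iterates;
  \<open>acpgm_gamma\<close> is only meaningful for \<open>k \<ge> 1\<close>.\<close>

definition acpgm_L :: "('a::real_inner \<Rightarrow> ereal) \<Rightarrow> real \<Rightarrow> (nat \<Rightarrow> 'a) \<Rightarrow> nat \<Rightarrow> real" where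
  "acpgm_L f L0 x k =
     (if k = 0 then L0
      else 2 * (real_of_ereal (f (x k)) - real_of_ereal (f (x (k - 1)))
                 - grad f (x (k - 1)) \<bullet> (x k - x (k - 1)))
             / (norm (x k - x (k - 1)))\<^sup>2)"

definition acpgm_gamma :: "('a::real_inner \<Rightarrow> ereal) \<Rightarrow> real \<Rightarrow> (nat \<Rightarrow> 'a) \<Rightarrow> nat \<Rightarrow> real" where
  "acpgm_gamma f L0 x k = Max (acpgm_L f L0 x ` {0..<k})"

definition acpgm_sequence ::
  "('a::real_inner \<Rightarrow> ereal) \<Rightarrow> ('a \<Rightarrow> ereal) \<Rightarrow> real \<Rightarrow> real \<Rightarrow> (nat \<Rightarrow> 'a) \<Rightarrow> bool" where
  "acpgm_sequence f g \<alpha> L0 x \<longleftrightarrow>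
     x 0 \<in> effective_domain g \<and>
     (\<forall>k\<ge>1. x k \<in> prox g (\<alpha> * acpgm_gamma f L0 x k)
        (x (k - 1) - (1 / (\<alpha> * acpgm_gamma f L0 x k)) *\<^sub>R grad f (x (k - 1))))"

text \<open>\<open>acpgm_R f \<alpha> L0 x k\<close> is the gradient mapping with parameter \<open>\<alpha> \<gamma>\<^sub>k\<close> at the iterate of
  index \<open>k - 1\<close>.\<close>

definition acpgm_R ::
  "('a::real_inner \<Rightarrow> ereal) \<Rightarrow> real \<Rightarrow> real \<Rightarrow> (nat \<Rightarrow> 'a) \<Rightarrow> nat \<Rightarrow> 'a" where
  "acpgm_R f \<alpha> L0 x k = (\<alpha> * acpgm_gamma f L0 x k) *\<^sub>R (x (k - 1) - x k)"

end

theory Submission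
  imports Defs
begin

text \<open>
  Comparing \<open>x\<^sup>k\<close> with \<open>x\<^sup>k\<^sup>-\<^sup>1\<close> in the proximal subproblem gives
  \<open>F(x\<^sup>k) \<le> F(x\<^sup>k\<^sup>-\<^sup>1) - (\<alpha>\<gamma>\<^sub>k - L\<^sub>k) d\<^sub>k\<^sup>2 / 2\<close> with \<open>d\<^sub>k = \<parallel>x\<^sup>k - x\<^sup>k\<^sup>-\<^sup>1\<parallel>\<close>.
  If \<open>L\<^sub>k \<le> \<beta>\<gamma>\<^sub>k\<close>, the decrease is at least \<open>(\<alpha>-1)\<gamma>\<^sub>k d\<^sub>k\<^sup>2 / 4\<close>. Otherwise this
  fails by at most \<open>L\<^sub>k d\<^sub>k\<^sup>2 / 2\<close>, which the Hoelder condition bounds by a constant times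
  \<open>L\<^sub>k\<close> to the power \<open>-(1+\<nu>)/(1-\<nu>)\<close>; since then \<open>\<gamma>\<^sub>k\<^sub>+\<^sub>1 > \<beta>\<gamma>\<^sub>k\<close>, these errors are dominated
  by a geometric series, whose sum yields \<open>C\<^sub>\<nu>\<close>. Hence
  \<open>\<Sum> \<gamma>\<^sub>l d\<^sub>l\<^sup>2 \<le> 4(\<Delta> + C\<^sub>\<nu>)/(\<alpha>-1)\<close>. If all \<open>\<gamma>\<^sub>l d\<^sub>l\<close> with \<open>l \<le> k\<close> exceed a
  threshold \<open>M\<close>, then either \<open>\<gamma>\<^sub>k = L\<^sub>0\<close>, or \<open>\<gamma>\<^sub>k = L\<^sub>j\<close> for some \<open>j < k\<close> and the Hoelder
  condition at \<open>j\<close> bounds \<open>\<gamma>\<^sub>k\<close> in terms of \<open>M\<close>; both contradict the bound on the sum.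
\<close>

section \<open>Hoelder error terms and their summation\<close>

text \<open>Because 1 + \<open>\<nu>\<close> < 2, dividing by \<open>d powr (1 + \<nu>)\<close>
  leaves a bound on \<open>d powr (1 - \<nu>)\<close>. Raised to the power (1 +
  \<open>\<nu>\<close>)/(1 - \<open>\<nu>\<close>) and put back on the right of
  \<open>holder\<close>, it eliminates \<open>d\<close>.\<close>

lemma holder_curvature_step_bound:
  fixes L d h \<nu> :: real
  assumes "0 < \<nu>" "\<nu> < 1" "0 < L" "0 < d" "0 < h"
    and holder: "L / 2 * d\<^sup>2 \<le> h * d powr (1 + \<nu>)"
  shows "L / 2 * d\<^sup>2 \<le> h powr (2 / (1 - \<nu>)) * (2 / L) powr ((1 + \<nu>) / (1 - \<nu>))"
proof -
  have "L / 2 * d powr (1 - \<nu>) * d powr (1 + \<nu>) = L / 2 * d\<^sup>2"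
    using assms by (simp add: powr_add[symmetric])
  then have "L / 2 * d powr (1 - \<nu>) \<le> h"
    using holder \<open>0 < d\<close> by (metis mult_le_cancel_right_pos powr_gt_zero less_numeral_extra(3))
  then have "d powr (1 - \<nu>) \<le> h * (2 / L)"
    using \<open>0 < L\<close> by (simp add: field_simps)
  then have "(d powr (1 - \<nu>)) powr ((1 + \<nu>) / (1 - \<nu>)) \<le> (h * (2 / L)) powr ((1 + \<nu>) / (1 - \<nu>))"
    using assms by (intro powr_mono2) auto
  moreover have "(d powr (1 - \<nu>)) powr ((1 + \<nu>) / (1 - \<nu>)) = d powr (1 + \<nu>)"
    using assms by (simp add: powr_powr)
  ultimately have "d powr (1 + \<nu>) \<le> (h * (2 / L)) powr ((1 + \<nu>) / (1 - \<nu>))"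
    by simp
  then have "L / 2 * d\<^sup>2 \<le> h * (h * (2 / L)) powr ((1 + \<nu>) / (1 - \<nu>))"
    using holder \<open>0 < h\<close> by (meson mult_left_mono less_imp_le order_trans)
  also have "\<dots> = h powr 1 * h powr ((1 + \<nu>) / (1 - \<nu>)) * (2 / L) powr ((1 + \<nu>) / (1 - \<nu>))"
    using assms by (subst powr_mult) auto
  also have "h powr 1 * h powr ((1 + \<nu>) / (1 - \<nu>)) = h powr (2 / (1 - \<nu>))"
    unfolding powr_add[symmetric] using assms by (intro arg_cong2[where f="(powr)"]) (auto simp: field_simps)
  finally show ?thesis .
qed

text \<open>The induction is on the sum plus the potential \<open>q / (1 - q) * \<gamma> (Suc k) powr (- p)\<close>,
  which does not increase from \<open>k\<close> to \<open>Suc k\<close>; here \<open>q = \<beta> powr (- p)\<close>.\<close>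

lemma sum_powr_jumps_le:
  fixes L \<gamma> :: "nat \<Rightarrow> real" and \<beta> p :: real
  assumes "1 < \<beta>" "0 < p" "0 < \<gamma> 1"
    and step: "\<And>k. 1 \<le> k \<Longrightarrow> \<gamma> (Suc k) = max (\<gamma> k) (L k)"
  shows "(\<Sum>l=1..k. if \<beta> * \<gamma> l < L l then L l powr (- p) else 0)
           \<le> 1 / (1 - \<beta> powr (- p)) * \<gamma> 1 powr (- p)"
proof -
  define q where "q = \<beta> powr (- p)"
  have q: "0 < q" "q < 1"
    using assms powr_less_mono[of "-p" 0 \<beta>] by (auto simp: q_def)
  have pos: "0 < \<gamma> (Suc k)" for k
    using assms(3) by (induction k) (auto simp: step)
  have "(\<Sum>l=1..k. if \<beta> * \<gamma> l < L l then L l powr (- p) else 0)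
          + q / (1 - q) * \<gamma> (Suc k) powr (- p) \<le> q / (1 - q) * \<gamma> 1 powr (- p)"
  proof (induction k)
    case 0
    then show ?case by simp
  next
    case (Suc k)
    let ?\<gamma> = "\<gamma> (Suc k)" and ?L = "L (Suc k)"
    have s: "\<gamma> (Suc (Suc k)) = max ?\<gamma> ?L" by (simp add: step)
    have "(if \<beta> * ?\<gamma> < ?L then ?L powr (- p) else 0) + q / (1 - q) * \<gamma> (Suc (Suc k)) powr (- p)
            \<le> q / (1 - q) * ?\<gamma> powr (- p)"
    proof (cases "\<beta> * ?\<gamma> < ?L")
      case True
      have "?\<gamma> < \<beta> * ?\<gamma>" using pos[of k] assms(1) by simp
      then have "max ?\<gamma> ?L = ?L" using True by simp
      moreover have "?L powr (- p) \<le> (\<beta> * ?\<gamma>) powr (- p)"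
        using True pos[of k] assms(1,2) by (intro powr_mono2') auto
      then have "?L powr (- p) \<le> q * ?\<gamma> powr (- p)"
        by (simp add: q_def powr_mult)
      then have "?L powr (- p) / (1 - q) \<le> q * ?\<gamma> powr (- p) / (1 - q)"
        using q by (intro divide_right_mono) auto
      \<comment> \<open>The new summand and the new potential merge into one term, which the old
        potential covers because a jump gains at least the factor \<open>q\<close>.\<close>
      moreover have "?L powr (- p) + q / (1 - q) * ?L powr (- p) = ?L powr (- p) / (1 - q)"
        using q by (simp add: field_simps)
      ultimately show ?thesis using True s by simp
    next
      case False
      have "\<gamma> (Suc (Suc k)) powr (- p) \<le> ?\<gamma> powr (- p)"
        using s pos[of k] assms(2) by (intro powr_mono2') auto
      then show ?thesis using False q by (auto intro!: mult_left_mono divide_right_mono)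
    qed
    then show ?case using Suc by simp
  qed
  moreover have "0 \<le> q / (1 - q) * \<gamma> (Suc k) powr (- p)"
    using q by simp
  \<comment> \<open>The constant is relaxed to the form that appears in
    \<open>C\<nu>\<close>.\<close>
  moreover have "q / (1 - q) * \<gamma> 1 powr (- p) \<le> 1 / (1 - q) * \<gamma> 1 powr (- p)"
    using q by (intro mult_right_mono divide_right_mono) auto
  ultimately show ?thesis
    unfolding q_def by linarith
qed

text \<open>Only real sequences remain here: \<open>\<phi>\<close> stands for the objective values,
  \<open>d\<close> for the step lengths and \<open>h\<close> for
  \<open>L\<nu> / (1 + \<nu>)\<close>. With \<open>\<gamma> 1\<close> equal to \<open>L0\<close>,
  the last summand is \<open>C\<nu>\<close>.\<close>

lemma auto_conditioned_sum_bound: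
  fixes L \<gamma> d \<phi> :: "nat \<Rightarrow> real" and \<alpha> \<beta> \<nu> h :: real
  assumes \<alpha>: "1 < \<alpha>" and \<beta>: "\<beta> = (\<alpha> + 1) / 2" and \<nu>: "0 < \<nu>" "\<nu> < 1" and h: "0 < h"
    and \<gamma>1: "0 < \<gamma> 1"
    and step: "\<And>k. 1 \<le> k \<Longrightarrow> \<gamma> (Suc k) = max (\<gamma> k) (L k)"
    and d: "\<And>k. 1 \<le> k \<Longrightarrow> 0 < d k"
    and holder: "\<And>k. 1 \<le> k \<Longrightarrow> L k / 2 * (d k)\<^sup>2 \<le> h * d k powr (1 + \<nu>)"
    and descent: "\<And>k. 1 \<le> k \<Longrightarrow> \<phi> k \<le> \<phi> (k - 1) - (\<alpha> * \<gamma> k - L k) / 2 * (d k)\<^sup>2"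
  shows "(\<alpha> - 1) / 4 * (\<Sum>l=1..k. \<gamma> l * (d l)\<^sup>2) \<le> \<phi> 0 - \<phi> k
           + 1 / (1 - \<beta> powr (- ((1 + \<nu>) / (1 - \<nu>)))) * h powr (2 / (1 - \<nu>))
             * (2 / \<gamma> 1) powr ((1 + \<nu>) / (1 - \<nu>))"
proof -
  define p where "p = (1 + \<nu>) / (1 - \<nu>)"
  define A where "A = h powr (2 / (1 - \<nu>)) * 2 powr p"
  define e where "e l = (if \<beta> * \<gamma> l < L l then L l powr (- p) else 0)" for l
  have p: "0 < p" using \<nu> by (simp add: p_def)
  have A: "0 < A" using h by (simp add: A_def)
  have two_div: "(2 / t) powr p = 2 powr p * t powr (- p)" if "0 < t" for t
    using that by (simp add: powr_divide powr_minus_divide)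
  have "0 < \<gamma> (Suc k)" for k
    using \<gamma>1 by (induction k) (auto simp: step)
  then have pos: "0 < \<gamma> k" if "1 \<le> k" for k
    using that by (cases k) auto
  have one: "(\<alpha> - 1) / 4 * (\<gamma> l * (d l)\<^sup>2) \<le> \<phi> (l - 1) - \<phi> l + A * e l" if l: "1 \<le> l" for l
  proof -
    \<comment> \<open>As \<open>\<beta>\<close> is the midpoint of 1 and \<open>\<alpha>\<close>,
      the retained decrease has the factor (\<open>\<alpha>\<close> - \<open>\<beta>\<close>)/2 =
      (\<open>\<alpha>\<close> - 1)/4.\<close>
    have split: "(\<alpha> * \<gamma> l - L l) / 2 * (d l)\<^sup>2
        = (\<alpha> - 1) / 4 * (\<gamma> l * (d l)\<^sup>2) - (L l - \<beta> * \<gamma> l) / 2 * (d l)\<^sup>2"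
      by (simp add: \<beta> field_simps)
    have "(L l - \<beta> * \<gamma> l) / 2 * (d l)\<^sup>2 \<le> A * e l"
    proof (cases "\<beta> * \<gamma> l < L l")
      case True
      have b: "0 < \<beta> * \<gamma> l" using pos[OF l] \<alpha> \<beta> by simp
      then have L: "0 < L l" using True by simp
      have "(L l - \<beta> * \<gamma> l) / 2 * (d l)\<^sup>2 \<le> L l / 2 * (d l)\<^sup>2"
        using b by (intro mult_right_mono) auto
      also have "\<dots> \<le> h powr (2 / (1 - \<nu>)) * (2 / L l) powr p"
        unfolding p_def
        using holder_curvature_step_bound[OF \<nu> L d[OF l] h holder[OF l]] .
      also have "\<dots> = A * e l"
        using True two_div[OF L] by (simp add: A_def e_def)
      finally show ?thesis .
    next
      case False
      then have "(L l - \<beta> * \<gamma> l) / 2 * (d l)\<^sup>2 \<le> 0"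
        by (intro mult_nonpos_nonneg) auto
      then show ?thesis using False by (simp add: e_def)
    qed
    then show ?thesis using descent[OF l] split by linarith
  qed
  have "(\<alpha> - 1) / 4 * (\<Sum>l=1..k. \<gamma> l * (d l)\<^sup>2) \<le> \<phi> 0 - \<phi> k + A * (\<Sum>l=1..k. e l)"
  proof (induction k)
    case 0
    then show ?case by simp
  next
    case (Suc k)
    then show ?case using one[of "Suc k"] by (simp add: distrib_left)
  qed
  also have "(\<Sum>l=1..k. e l) \<le> 1 / (1 - \<beta> powr (- p)) * \<gamma> 1 powr (- p)"
    unfolding e_def using \<alpha> \<beta> by (intro sum_powr_jumps_le p \<gamma>1 step) auto
  then have "A * (\<Sum>l=1..k. e l) \<le> A * (1 / (1 - \<beta> powr (- p)) * \<gamma> 1 powr (- p))"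
    using A by (intro mult_left_mono) auto
  also have "A * (1 / (1 - \<beta> powr (- p)) * \<gamma> 1 powr (- p))
      = 1 / (1 - \<beta> powr (- p)) * h powr (2 / (1 - \<nu>)) * (2 / \<gamma> 1) powr p"
    unfolding two_div[OF \<gamma>1] by (simp add: A_def)
  finally show ?thesis by (simp add: p_def)
qed

section \<open>Running maxima and the smallest scaled step\<close>

lemma running_max_attained:
  fixes L \<gamma> :: "nat \<Rightarrow> 'b::linorder"
  assumes step: "\<And>k. 1 \<le> k \<Longrightarrow> \<gamma> (Suc k) = max (\<gamma> k) (L k)" and "1 \<le> k"
  shows "\<gamma> k = \<gamma> 1 \<or> (\<exists>j. 1 \<le> j \<and> j < k \<and> \<gamma> k = L j)"
  using \<open>1 \<le> k\<close>
proof (induction k rule: dec_induct)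
  case base
  then show ?case by simp
next
  case (step n)
  then show ?case using assms(1)[of n] by (auto simp: max_def less_Suc_eq)
qed

lemma running_max_mono:
  fixes L \<gamma> :: "nat \<Rightarrow> 'b::linorder"
  assumes step: "\<And>k. 1 \<le> k \<Longrightarrow> \<gamma> (Suc k) = max (\<gamma> k) (L k)" and "1 \<le> l" "l \<le> k"
  shows "\<gamma> l \<le> \<gamma> k"
  using \<open>l \<le> k\<close>
proof (induction k rule: dec_induct)
  case (step n)
  then show ?case using assms(1)[of n] \<open>1 \<le> l\<close> by (auto simp: max_def)
qed simp

text \<open>Up to the factor 4, \<open>D\<close> is the budget per iteration. The two entries of the
  maximum answer the two possible origins of \<open>\<gamma> k\<close>: the initial value or an
  earlier curvature estimate.\<close>

lemma auto_conditioned_min_step_le: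
  fixes L \<gamma> d :: "nat \<Rightarrow> real" and \<nu> h D :: real
  assumes \<nu>: "0 < \<nu>" "\<nu> < 1" and h: "0 < h" and D: "0 < D" and k: "1 \<le> k"
    and \<gamma>1: "0 < \<gamma> 1"
    and step: "\<And>k. 1 \<le> k \<Longrightarrow> \<gamma> (Suc k) = max (\<gamma> k) (L k)"
    and d: "\<And>k. 1 \<le> k \<Longrightarrow> 0 < d k"
    and holder: "\<And>k. 1 \<le> k \<Longrightarrow> L k / 2 * (d k)\<^sup>2 \<le> h * d k powr (1 + \<nu>)"
    and sum: "(\<Sum>l=1..k. \<gamma> l * (d l)\<^sup>2) \<le> 4 * (real k * D)"
  shows "\<exists>l\<in>{1..k}. \<gamma> l * d l \<le> max (2 * sqrt (\<gamma> 1 * D))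
           ((2 powr (1 + 2 * \<nu>) * h) powr (1 / (1 + \<nu>)) * D powr (\<nu> / (1 + \<nu>)))"
proof (rule ccontr)
  define M where "M = max (2 * sqrt (\<gamma> 1 * D))
           ((2 powr (1 + 2 * \<nu>) * h) powr (1 / (1 + \<nu>)) * D powr (\<nu> / (1 + \<nu>)))"
  define c where "c = 2 * h"
  assume "\<not> ?thesis"
  then have big: "M < \<gamma> l * d l" if "1 \<le> l" "l \<le> k" for l
    using that by (force simp: M_def not_le)
  have "0 < 2 * sqrt (\<gamma> 1 * D)" using \<gamma>1 D by simp
  then have M: "0 < M" unfolding M_def by linarith
  have c: "0 < c" using h by (simp add: c_def)
  have mono: "\<gamma> l \<le> \<gamma> n" if "1 \<le> l" "l \<le> n" for l n
    using running_max_mono[of \<gamma> L, OF step that] by blast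
  have pos: "0 < \<gamma> l" if "1 \<le> l" for l
    using mono[of 1 l] that \<gamma>1 by simp
  \<comment> \<open>Multiplying by the largest weight \<open>\<gamma> k\<close> makes each summand
    at least (\<open>\<gamma> l * d l\<close>) squared, so averaging forces a lower bound on
    \<open>\<gamma> k\<close>.\<close>
  have "real k * M\<^sup>2 = (\<Sum>l=1..k. M\<^sup>2)" by simp
  also have "\<dots> < (\<Sum>l=1..k. \<gamma> k * (\<gamma> l * (d l)\<^sup>2))"
  proof (rule sum_strict_mono)
    fix l assume l: "l \<in> {1..k}"
    then have "M\<^sup>2 < (\<gamma> l * d l)\<^sup>2"
      using big[of l] M by (intro power_strict_mono) auto
    also have "\<dots> = \<gamma> l * (\<gamma> l * (d l)\<^sup>2)" by (simp add: power2_eq_square)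
    also have "\<dots> \<le> \<gamma> k * (\<gamma> l * (d l)\<^sup>2)"
      using mono[of l k] pos[of l] l by (intro mult_right_mono) auto
    finally show "M\<^sup>2 < \<gamma> k * (\<gamma> l * (d l)\<^sup>2)" .
  qed (use k in auto)
  also have "\<dots> \<le> \<gamma> k * (4 * (real k * D))"
    unfolding sum_distrib_left[symmetric]
    using sum pos[OF k] by (intro mult_left_mono) auto
  finally have "real k * M\<^sup>2 < real k * (4 * \<gamma> k * D)" by (simp add: mult_ac)
  then have *: "M\<^sup>2 < 4 * \<gamma> k * D" using k by simp
  from running_max_attained[of \<gamma> L, OF step k]
  consider "\<gamma> k = \<gamma> 1" | j where "1 \<le> j" "j < k" "\<gamma> k = L j" by blast
  then show False
  proof cases
    case 1
    have "(2 * sqrt (\<gamma> 1 * D))\<^sup>2 \<le> M\<^sup>2"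
      using \<gamma>1 D by (intro power_mono) (auto simp: M_def)
    then show False using * 1 \<gamma>1 D by (simp add: power_mult_distrib)
  next
    case (2 j)
    let ?d = "d j"
    have dj: "0 < ?d" using d 2 by blast
    have "L j * ?d\<^sup>2 \<le> c * ?d powr (1 + \<nu>)"
      using holder[OF 2(1)] by (simp add: c_def)
    also have "\<dots> = c * ?d powr (\<nu> - 1) * ?d\<^sup>2"
      using dj powr_add[of ?d "\<nu> - 1" 2] by (simp add: add.commute)
    finally have Lj: "\<gamma> k \<le> c * ?d powr (\<nu> - 1)" using dj 2 by simp
    \<comment> \<open>The step at \<open>j\<close> cannot be short: \<open>M\<close> <
      \<open>\<gamma> k * ?d\<close>, while \<open>Lj\<close> bounds \<open>\<gamma> k\<close>.
      Since the exponent \<open>\<nu>\<close> - 1 is negative, a lower bound on \<open>?d\<close>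
      becomes an upper bound on \<open>\<gamma> k\<close>.\<close>
    have "M < \<gamma> j * ?d" using big 2 by simp
    also have "\<dots> \<le> \<gamma> k * ?d" using mono[of j k] 2 dj by (intro mult_right_mono) auto
    also have "\<dots> \<le> c * ?d powr (\<nu> - 1) * ?d" using Lj dj by (intro mult_right_mono) auto
    also have "\<dots> = c * ?d powr \<nu>" using dj powr_add[of ?d "\<nu> - 1" 1] by simp
    finally have "M / c < ?d powr \<nu>" using c by (simp add: field_simps)
    then have "(M / c) powr (1 / \<nu>) \<le> (?d powr \<nu>) powr (1 / \<nu>)"
      using M c \<nu> by (intro powr_mono2) auto
    then have "(M / c) powr (1 / \<nu>) \<le> ?d" using dj \<nu> by (simp add: powr_powr)
    then have "?d powr (\<nu> - 1) \<le> ((M / c) powr (1 / \<nu>)) powr (\<nu> - 1)"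
      using M c \<nu> by (intro powr_mono2') auto
    also have "\<dots> = (M / c) powr ((\<nu> - 1) / \<nu>)" by (simp add: powr_powr)
    finally have "\<gamma> k \<le> c * (M / c) powr ((\<nu> - 1) / \<nu>)"
      using Lj c by (meson mult_left_mono less_imp_le order_trans)
    then have "4 * D * \<gamma> k \<le> 4 * D * (c * (M / c) powr ((\<nu> - 1) / \<nu>))"
      using D by (intro mult_left_mono) auto
    then have "M\<^sup>2 < 4 * D * (c * (M / c) powr ((\<nu> - 1) / \<nu>))"
      using * by (simp add: mult_ac)
    \<comment> \<open>Logarithms make the condition on \<open>M\<close> linear. The second entry of
      the maximum is exactly the value at which (1 + \<open>\<nu>\<close>) \<open>ln M\<close>
      equals \<open>ln c + \<nu> * ln (4 * D)\<close>, so the strict inequality is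
      contradictory.\<close>
    then have "ln (M\<^sup>2) < ln (4 * D * (c * (M / c) powr ((\<nu> - 1) / \<nu>)))"
      using M D c by (subst ln_less_cancel_iff) auto
    then have "2 * ln M < ln (4 * D) + ln c + (\<nu> - 1) / \<nu> * (ln M - ln c)"
      using M D c by (simp add: ln_mult ln_powr ln_div ln_realpow)
    then have "\<nu> * (2 * ln M) < \<nu> * (ln (4 * D) + ln c + (\<nu> - 1) / \<nu> * (ln M - ln c))"
      using \<nu> by simp
    also have "\<dots> = \<nu> * (ln (4 * D) + ln c) + (\<nu> - 1) * (ln M - ln c)"
      using \<nu> by (simp add: field_simps)
    finally have lt: "(1 + \<nu>) * ln M < ln c + \<nu> * ln (4 * D)"
      by (simp add: algebra_simps)
    have "(2 powr (1 + 2 * \<nu>) * h) powr (1 / (1 + \<nu>)) * D powr (\<nu> / (1 + \<nu>)) \<le> M"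
      by (simp add: M_def)
    then have "ln ((2 powr (1 + 2 * \<nu>) * h) powr (1 / (1 + \<nu>)) * D powr (\<nu> / (1 + \<nu>))) \<le> ln M"
      using h D M by (subst ln_le_cancel_iff) auto
    then have "1 / (1 + \<nu>) * ((1 + 2 * \<nu>) * ln 2 + ln h) + \<nu> / (1 + \<nu>) * ln D \<le> ln M"
      using h D by (simp add: ln_mult ln_powr)
    then have "(1 + \<nu>) * (1 / (1 + \<nu>) * ((1 + 2 * \<nu>) * ln 2 + ln h) + \<nu> / (1 + \<nu>) * ln D)
        \<le> (1 + \<nu>) * ln M"
      using \<nu> by (intro mult_left_mono) auto
    also have "(1 + \<nu>) * (1 / (1 + \<nu>) * ((1 + 2 * \<nu>) * ln 2 + ln h) + \<nu> / (1 + \<nu>) * ln D)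
        = (1 + 2 * \<nu>) * ln 2 + ln h + \<nu> * ln D"
      using \<nu> by (simp add: distrib_left)
    finally have "(1 + 2 * \<nu>) * ln 2 + ln h + \<nu> * ln D \<le> (1 + \<nu>) * ln M" .
    moreover have "ln c = ln 2 + ln h" using h by (simp add: c_def ln_mult)
    moreover have "ln (4 * D) = 2 * ln 2 + ln D"
      using D ln_realpow[of 2 2] by (simp add: ln_mult)
    ultimately show False using lt by (simp add: algebra_simps)
  qed
qed

section \<open>The proximal step and the asymptotic rate\<close>

text \<open>Minimality of \<open>y\<close> is tested against \<open>z\<close> itself. Expanding the
  square around \<open>y - z\<close> produces the linear term in \<open>v\<close>, and the squared
  norm of \<open>v / c\<close> cancels.\<close>

lemma prox_gradient_inequality:
  fixes g :: "'a::real_inner \<Rightarrow> ereal"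
  assumes c: "0 < c" and y: "y \<in> prox g c (z - (1 / c) *\<^sub>R v)"
    and g: "g z < \<infinity>" "\<forall>w. g w \<noteq> -\<infinity>"
  shows "g y < \<infinity>"
    and "real_of_ereal (g y) + v \<bullet> (y - z) + c / 2 * (norm (y - z))\<^sup>2 \<le> real_of_ereal (g z)"
proof -
  let ?w = "z - (1 / c) *\<^sub>R v"
  have le: "g y + ereal (c / 2 * (norm (y - ?w))\<^sup>2) \<le> g z + ereal (c / 2 * (norm (z - ?w))\<^sup>2)"
    using y unfolding prox_def is_arg_min_def mem_Collect_eq not_ex by (metis not_less)
  obtain b where b: "g z = ereal b" using g by (cases "g z") auto
  obtain a where a: "g y = ereal a" using g le b by (cases "g y") auto
  show "g y < \<infinity>" by (simp add: a)
  have eqs: "y - ?w = (y - z) + (1 / c) *\<^sub>R v" "z - ?w = (1 / c) *\<^sub>R v"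
    by (simp_all add: algebra_simps)
  have "a + c / 2 * (norm ((y - z) + (1 / c) *\<^sub>R v))\<^sup>2
      \<le> b + c / 2 * (norm ((1 / c) *\<^sub>R v))\<^sup>2"
    using le unfolding a b eqs plus_ereal.simps ereal_less_eq .
  moreover have "c / 2 * (norm ((y - z) + (1 / c) *\<^sub>R v))\<^sup>2
      = c / 2 * (norm (y - z))\<^sup>2 + v \<bullet> (y - z) + c / 2 * (norm ((1 / c) *\<^sub>R v))\<^sup>2"
  proof -
    have "(norm ((y - z) + u))\<^sup>2 = (norm (y - z))\<^sup>2 + 2 * (u \<bullet> (y - z)) + (norm u)\<^sup>2" for u
      by (simp add: power2_norm_eq_inner inner_add_left inner_add_right inner_commute)
    from this[of "(1 / c) *\<^sub>R v"] show ?thesis using c by (simp add: field_simps)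
  qed
  ultimately show "real_of_ereal (g y) + v \<bullet> (y - z) + c / 2 * (norm (y - z))\<^sup>2 \<le> real_of_ereal (g z)"
    unfolding a b real_of_ereal.simps by linarith
qed

text \<open>For \<open>k\<close> at least 1 and \<open>r\<close> at most 1/2, the square-root term
  decays no slower than \<open>real k powr (- r)\<close>; the maximum is then bounded by the sum of
  both terms.\<close>

lemma max_sqrt_powr_bigo:
  fixes A B D \<alpha> a r :: real
  assumes "0 \<le> A" "0 \<le> B" "0 \<le> D" "0 < a" "0 \<le> r" "r \<le> 1 / 2"
  shows "(\<lambda>k. \<alpha> * max (2 * sqrt (A * D / (a * real k))) (B * (D / (a * real k)) powr r))
           \<in> O(\<lambda>k. real k powr (- r))"
proof (rule bigoI)
  show "\<forall>\<^sub>F k in sequentially.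
    norm (\<alpha> * max (2 * sqrt (A * D / (a * real k))) (B * (D / (a * real k)) powr r))
      \<le> (\<bar>\<alpha>\<bar> * (2 * sqrt (A * D / a) + B * (D / a) powr r)) * norm (real k powr (- r))"
    using eventually_gt_at_top[of 0]
  proof eventually_elim
    case (elim k)
    let ?k = "real k"
    have k: "1 \<le> ?k" using elim by simp
    have "sqrt (A * D / (a * ?k)) = sqrt (A * D / a) * ?k powr (- (1 / 2))"
      using k by (simp add: powr_minus_divide powr_half_sqrt real_sqrt_divide real_sqrt_mult)
    also have "\<dots> \<le> sqrt (A * D / a) * ?k powr (- r)"
      using k assms by (intro mult_left_mono powr_mono) auto
    finally have 1: "2 * sqrt (A * D / (a * ?k)) \<le> 2 * sqrt (A * D / a) * ?k powr (- r)" by simp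
    have 2: "B * (D / (a * ?k)) powr r = B * (D / a) powr r * ?k powr (- r)"
      using k assms by (simp add: powr_divide powr_mult powr_minus_divide)
    have 3: "0 \<le> B * (D / a) powr r * ?k powr (- r)" "0 \<le> 2 * sqrt (A * D / a) * ?k powr (- r)"
      using assms by auto
    have "0 \<le> 2 * sqrt (A * D / (a * ?k))" using assms k by simp
    then have "\<bar>max (2 * sqrt (A * D / (a * ?k))) (B * (D / (a * ?k)) powr r)\<bar>
        \<le> 2 * sqrt (A * D / a) * ?k powr (- r) + B * (D / a) powr r * ?k powr (- r)"
      using 1 2 3 by linarith
    then have "\<bar>\<alpha>\<bar> * \<bar>max (2 * sqrt (A * D / (a * ?k))) (B * (D / (a * ?k)) powr r)\<bar>
        \<le> \<bar>\<alpha>\<bar> * (2 * sqrt (A * D / a) * ?k powr (- r) + B * (D / a) powr r * ?k powr (- r))"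
      by (intro mult_left_mono) auto
    then show ?case by (simp add: abs_mult algebra_simps)
  qed
qed

section \<open>Application to the iterates\<close>

theorem theorem2p3:
  fixes f g F :: "'a::euclidean_space \<Rightarrow> ereal"
    and Fstar :: ereal
    and x :: "nat \<Rightarrow> 'a"
    and \<alpha> L0 \<nu> L\<nu> \<Delta> \<beta> C\<nu> :: real
    and bound :: "nat \<Rightarrow> real"
  assumes f_range: "\<forall>y. f y \<noteq> -\<infinity>"
    and f_lsc: "lower_semicontinuous f"
    and f_C1: "continuously_differentiable_near f (effective_domain g)"
    and g_proper: "proper g"
    and g_lsc: "lower_semicontinuous g"
    and F_def: "F = (\<lambda>y. f y + g y)"
    and Fstar_def: "Fstar = (INF y. F y)"
    and Fstar_bounded: "Fstar > -\<infinity>"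
    and prox_nonempty: "\<forall>\<gamma>>0. \<forall>y. prox g \<gamma> y \<noteq> {}"
    and nu: "0 < \<nu>" "\<nu> < 1"
    and Lnu: "L\<nu> > 0"
    and descent: "\<forall>y\<in>effective_domain g. \<forall>z\<in>effective_domain g.
      f y \<le> f z + ereal (grad f z \<bullet> (y - z) + L\<nu> / (1 + \<nu>) * norm (y - z) powr (1 + \<nu>))"
    and alpha: "\<alpha> > 1"
    and L0: "L0 > 0"
    and acpgm: "acpgm_sequence f g \<alpha> L0 x"
    and x_step: "\<forall>k\<ge>1. x k \<noteq> x (k - 1)"
    and Delta_def: "\<Delta> = real_of_ereal (F (x 0) - Fstar)"
    and beta_def: "\<beta> = (\<alpha> + 1) / 2"
    and Cnu_def: "C\<nu> = 1 / (1 - \<beta> powr (- ((1 + \<nu>) / (1 - \<nu>))))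
                        * (L\<nu> / (1 + \<nu>)) powr (2 / (1 - \<nu>))
                        * (2 / L0) powr ((1 + \<nu>) / (1 - \<nu>))"
    and bound_def: "bound = (\<lambda>k. \<alpha> * max
          (2 * sqrt (L0 * (\<Delta> + C\<nu>) / ((\<alpha> - 1) * real k)))
          ((2 powr (1 + 2 * \<nu>) * L\<nu> / (1 + \<nu>)) powr (1 / (1 + \<nu>))
             * ((\<Delta> + C\<nu>) / ((\<alpha> - 1) * real k)) powr (\<nu> / (1 + \<nu>))))"
  shows "(\<forall>k\<ge>1. Min ((\<lambda>l. norm (acpgm_R f \<alpha> L0 x l)) ` {1..k}) \<le> bound k) \<and>
         bound \<in> O(\<lambda>k. real k powr (- (\<nu> / (1 + \<nu>))))"
proof -
  define L where "L = acpgm_L f L0 x"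
  define \<gamma> where "\<gamma> = acpgm_gamma f L0 x"
  define d where "d k = norm (x k - x (k - 1))" for k
  define h where "h = L\<nu> / (1 + \<nu>)"
  define \<phi> where "\<phi> k = real_of_ereal (f (x k)) + real_of_ereal (g (x k))" for k
  define \<delta> where "\<delta> k = grad f (x (k - 1)) \<bullet> (x k - x (k - 1))" for k
  have h: "0 < h" using Lnu nu by (simp add: h_def)
  have \<gamma>1: "\<gamma> 1 = L0" by (simp add: \<gamma>_def acpgm_gamma_def acpgm_L_def)
  have step: "\<gamma> (Suc k) = max (\<gamma> k) (L k)" if "1 \<le> k" for k
  proof -
    \<comment> \<open>\<open>\<gamma> k\<close> looks only at indices below \<open>k\<close>, so
      \<open>L k\<close> first enters at \<open>Suc k\<close>. For \<open>k\<close> at least 1 the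
      old range is nonempty, as \<open>Max\<close> requires.\<close>
    have "{0..<Suc k} = insert k {0..<k}" by auto
    then show ?thesis
      using that by (simp add: \<gamma>_def L_def acpgm_gamma_def max.commute)
  qed
  have \<gamma>pos: "0 < \<gamma> k" if "1 \<le> k" for k
    using running_max_mono[of \<gamma> L, OF step _ that] \<gamma>1 L0 by fastforce
  have d: "0 < d k" if "1 \<le> k" for k
    using x_step that by (simp add: d_def)
  have g_ninf: "\<forall>w. g w \<noteq> -\<infinity>" using g_proper by (simp add: proper_def)
  have prox: "x k \<in> prox g (\<alpha> * \<gamma> k) (x (k - 1) - (1 / (\<alpha> * \<gamma> k)) *\<^sub>R grad f (x (k - 1)))"
    if "1 \<le> k" for k
    using acpgm that by (simp add: acpgm_sequence_def \<gamma>_def)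
  have \<alpha>\<gamma>: "0 < \<alpha> * \<gamma> k" if "1 \<le> k" for k
    using \<gamma>pos[OF that] alpha by simp
  have dom: "g (x k) < \<infinity>" for k
  proof (induction k)
    case 0
    then show ?case using acpgm by (simp add: acpgm_sequence_def effective_domain_def)
  next
    case (Suc k)
    then show ?case
      using prox_gradient_inequality(1)[OF \<alpha>\<gamma>[of "Suc k"] prox[of "Suc k"]] g_ninf by simp
  qed
  then have xdom: "x k \<in> effective_domain g" for k by (simp add: effective_domain_def)
  \<comment> \<open>Finiteness at the iterates makes the passage through
    \<open>real_of_ereal\<close> faithful.\<close>
  have f_fin: "\<bar>f (x k)\<bar> \<noteq> \<infinity>" for k
  proof -
    obtain U where "effective_domain g \<subseteq> U" "\<forall>y\<in>U. \<bar>f y\<bar> \<noteq> \<infinity>"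
      using f_C1 unfolding continuously_differentiable_near_def by metis
    then show ?thesis using xdom[of k] by (metis subsetD)
  qed
  have g_fin: "\<bar>g (x k)\<bar> \<noteq> \<infinity>" for k
    using dom[of k] g_ninf[rule_format, of "x k"] by auto
  have F: "F (x k) = ereal (\<phi> k)" for k
    using f_fin[of k] g_fin[of k] unfolding F_def \<phi>_def
    by (cases "f (x k)"; cases "g (x k)") auto
  \<comment> \<open>\<open>L k\<close> is the exact curvature between consecutive iterates, hence an
    equality; \<open>d k\<close> > 0 excludes division by zero.\<close>
  have curv: "L k / 2 * (d k)\<^sup>2
      = real_of_ereal (f (x k)) - real_of_ereal (f (x (k - 1))) - \<delta> k" if "1 \<le> k" for k
    using that d[OF that] by (simp add: L_def acpgm_L_def d_def \<delta>_def)
  have holder: "L k / 2 * (d k)\<^sup>2 \<le> h * d k powr (1 + \<nu>)" if "1 \<le> k" for k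
  proof -
    have "f (x k) \<le> f (x (k - 1)) + ereal (\<delta> k + h * d k powr (1 + \<nu>))"
      using descent xdom unfolding \<delta>_def h_def d_def by blast
    then have "real_of_ereal (f (x k))
        \<le> real_of_ereal (f (x (k - 1))) + (\<delta> k + h * d k powr (1 + \<nu>))"
      using f_fin[of k] f_fin[of "k - 1"] by (cases "f (x k)"; cases "f (x (k - 1))") auto
    then show ?thesis using curv[OF that] by linarith
  qed
  have decrease: "\<phi> k \<le> \<phi> (k - 1) - (\<alpha> * \<gamma> k - L k) / 2 * (d k)\<^sup>2" if "1 \<le> k" for k
  proof -
    have "real_of_ereal (g (x k)) + \<delta> k + \<alpha> * \<gamma> k / 2 * (d k)\<^sup>2 \<le> real_of_ereal (g (x (k - 1)))"
      unfolding \<delta>_def d_def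
      using prox_gradient_inequality(2)[OF \<alpha>\<gamma> prox dom g_ninf] that by blast
    moreover have "(\<alpha> * \<gamma> k - L k) / 2 * (d k)\<^sup>2 = \<alpha> * \<gamma> k / 2 * (d k)\<^sup>2 - L k / 2 * (d k)\<^sup>2"
      by (simp add: field_simps)
    ultimately show ?thesis using curv[OF that] unfolding \<phi>_def by linarith
  qed
  have Fle: "Fstar \<le> ereal (\<phi> k)" for k
    unfolding Fstar_def F[symmetric] by (rule INF_lower) simp
  obtain m where m: "Fstar = ereal m"
    using Fle[of 0] Fstar_bounded by (cases Fstar) auto
  have \<Delta>: "\<Delta> = \<phi> 0 - m" by (simp add: Delta_def F m)
  have m_le: "m \<le> \<phi> k" for k using Fle[of k] m by simp
  have "1 < \<beta>" using alpha beta_def by simp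
  then have "\<beta> powr (- ((1 + \<nu>) / (1 - \<nu>))) < 1"
    using nu powr_less_mono[of "- ((1 + \<nu>) / (1 - \<nu>))" 0 \<beta>] by simp
  \<comment> \<open>Strict positivity keeps the budget \<open>D\<close> below positive even if
    \<open>\<Delta>\<close> is 0.\<close>
  then have "0 < C\<nu>" unfolding Cnu_def using Lnu nu L0 by simp
  then have E: "0 < \<Delta> + C\<nu>" using m_le[of 0] \<Delta> by simp
  have bound: "Min ((\<lambda>l. norm (acpgm_R f \<alpha> L0 x l)) ` {1..k}) \<le> bound k" if k: "1 \<le> k" for k
  proof -
    \<comment> \<open>Chosen so that the summed bound
      4(\<open>\<Delta> + C\<nu>\<close>)/(\<open>\<alpha>\<close> - 1) becomes
      \<open>4 * (real k * D)\<close>.\<close>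
    define D where "D = (\<Delta> + C\<nu>) / ((\<alpha> - 1) * real k)"
    have D: "0 < D" using E alpha k by (simp add: D_def)
    have "(\<alpha> - 1) / 4 * (\<Sum>l=1..k. \<gamma> l * (d l)\<^sup>2) \<le> \<phi> 0 - \<phi> k + C\<nu>"
      using auto_conditioned_sum_bound[of \<alpha> \<beta> \<nu> h \<gamma> L d \<phi> k,
          OF alpha beta_def nu h \<gamma>pos[OF order_refl] step d holder decrease]
      unfolding \<gamma>1 Cnu_def h_def by blast
    also have "\<dots> \<le> \<Delta> + C\<nu>" using m_le[of k] \<Delta> by simp
    also have "\<dots> = (\<alpha> - 1) / 4 * (4 * (real k * D))"
    proof -
      have "(\<alpha> - 1) * real k \<noteq> 0" using alpha k by simp
      then have "((\<alpha> - 1) * real k) * D = \<Delta> + C\<nu>" unfolding D_def by simp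
      then show ?thesis by (simp add: field_simps)
    qed
    finally have "(\<Sum>l=1..k. \<gamma> l * (d l)\<^sup>2) \<le> 4 * (real k * D)"
      using alpha by (subst (asm) mult_le_cancel_left_pos) auto
    then obtain l where l: "l \<in> {1..k}" and le: "\<gamma> l * d l \<le> max (2 * sqrt (L0 * D))
           ((2 powr (1 + 2 * \<nu>) * h) powr (1 / (1 + \<nu>)) * D powr (\<nu> / (1 + \<nu>)))"
      using auto_conditioned_min_step_le[of \<nu> h D k \<gamma> L d,
          OF nu h D k \<gamma>pos[OF order_refl] step d holder]
      unfolding \<gamma>1 by blast
    have "norm (acpgm_R f \<alpha> L0 x l) = \<alpha> * (\<gamma> l * d l)"
      using alpha \<gamma>pos[of l] l
      by (simp add: acpgm_R_def \<gamma>_def[symmetric] d_def abs_mult norm_minus_commute)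
    also have "\<dots> \<le> bound k"
      unfolding bound_def using le alpha by (simp add: D_def h_def mult_left_mono)
    finally show ?thesis using l by (subst Min_le_iff) auto
  qed
  have "\<nu> / (1 + \<nu>) \<le> 1 / 2" using nu by (simp add: field_simps)
  then have "bound \<in> O(\<lambda>k. real k powr (- (\<nu> / (1 + \<nu>))))"
    unfolding bound_def using nu L0 E alpha
    by (intro max_sqrt_powr_bigo) auto
  with bound show ?thesis by blast
qed

end
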